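(* Let $\pi(x,y):=\langle x\rangle\uplus(\langle x\rangle\uplus\langle y\rangle)$. Then $$\mathsf{F}^{-}\vdash\ \pi(x,y)=\pi(u,v)\ \rightarrow\ (x=u\wedge y=v).$$
   Context: The theory $\mathsf{F}^{-}$ is a first-order theory with equality in the language $L=\{\emptyset,\langle\cdot\rangle,\uplus,\sqsubseteq\}$ (constant, unary function, binary function, binary relation), with axioms (all free variables universally quantified): $\mathrm{F}_1$: $(x\uplus y)\uplus z=x\uplus(y\uplus z)$; $\mathrm{F}_2$: $x\uplus y=y\uplus x$; $\mathrm{F}_3$: $x\uplus\emptyset=x$; $\mathrm{F}_4$: $x\uplus z=y\uplus z\rightarrow x=y$; $\mathrm{F}_5$: $\langle x\rangle\ne\emptyset$; $\mathrm{F}_6$: $x\uplus y=\emptyset\rightarrow x=\emptyset$; $\mathrm{F}_7$: $\langle x\rangle=\langle y\rangle\rightarrow x=y$; $\mathrm{F}_8$: $u\uplus v=\langle x\rangle\uplus w\rightarrow\exists w'\,(u=\langle x\rangle\uplus w'\vee v=\langle x\rangle\uplus w')$; $\mathrm{F}_9$: $x\sqsubseteq t\leftrightarrow\bigl(x=t\vee\exists w\,\exists u\,(t=w\uplus\langle u\rangle\wedge x\sqsubseteq u)\bigr)$. Free variables in the displayed formula are implicitly universally quantified. *)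

theory Defs
  imports Main
begin

text \<open>
  Classical first-order logic with equality over the language
  \<open>{\<emptyset>, \<langle>_\<rangle>, \<uplus>, \<sqsubseteq>}\<close>. Variables are de Bruijn indices: \<open>Var n\<close> refers to the quantifier
  with \<open>n\<close> further quantifiers between it and the occurrence.
\<close>

datatype trm =
    Var nat
  | Emp
  | Sing trm
  | Uplus trm trm  (infixr "\<^bold>\<uplus>" 85)

datatype fm =
    Falsum
  | Eq trm trm  (infix "\<^bold>=" 75)
  | Sqsub trm trm  (infix "\<^bold>\<sqsubseteq>" 75)
  | Imp fm fm  (infixr "\<^bold>\<longrightarrow>" 55)
  | Con fm fm  (infixr "\<^bold>\<and>" 65)
  | Dis fm fm  (infixr "\<^bold>\<or>" 60)
  | Forall fm
  | Exists fm

abbreviation Neg :: "fm \<Rightarrow> fm" where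
  "Neg p \<equiv> p \<^bold>\<longrightarrow> Falsum"

abbreviation Iff :: "fm \<Rightarrow> fm \<Rightarrow> fm"  (infix "\<^bold>\<longleftrightarrow>" 50) where
  "p \<^bold>\<longleftrightarrow> q \<equiv> (p \<^bold>\<longrightarrow> q) \<^bold>\<and> (q \<^bold>\<longrightarrow> p)"

text \<open>Simultaneous capture-avoiding substitution.\<close>

primrec subst_trm :: "(nat \<Rightarrow> trm) \<Rightarrow> trm \<Rightarrow> trm" where
  "subst_trm \<sigma> (Var n) = \<sigma> n"
| "subst_trm \<sigma> Emp = Emp"
| "subst_trm \<sigma> (Sing t) = Sing (subst_trm \<sigma> t)"
| "subst_trm \<sigma> (s \<^bold>\<uplus> t) = subst_trm \<sigma> s \<^bold>\<uplus> subst_trm \<sigma> t"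

definition under :: "(nat \<Rightarrow> trm) \<Rightarrow> nat \<Rightarrow> trm" where
  "under \<sigma> = case_nat (Var 0) (\<lambda>n. subst_trm (\<lambda>k. Var (Suc k)) (\<sigma> n))"

primrec subst :: "(nat \<Rightarrow> trm) \<Rightarrow> fm \<Rightarrow> fm" where
  "subst \<sigma> Falsum = Falsum"
| "subst \<sigma> (s \<^bold>= t) = (subst_trm \<sigma> s \<^bold>= subst_trm \<sigma> t)"
| "subst \<sigma> (s \<^bold>\<sqsubseteq> t) = (subst_trm \<sigma> s \<^bold>\<sqsubseteq> subst_trm \<sigma> t)"
| "subst \<sigma> (p \<^bold>\<longrightarrow> q) = (subst \<sigma> p \<^bold>\<longrightarrow> subst \<sigma> q)"
| "subst \<sigma> (p \<^bold>\<and> q) = (subst \<sigma> p \<^bold>\<and> subst \<sigma> q)"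
| "subst \<sigma> (p \<^bold>\<or> q) = (subst \<sigma> p \<^bold>\<or> subst \<sigma> q)"
| "subst \<sigma> (Forall p) = Forall (subst (under \<sigma>) p)"
| "subst \<sigma> (Exists p) = Exists (subst (under \<sigma>) p)"

text \<open>
  \<open>inst t p\<close> substitutes \<open>t\<close> for index 0 and lowers the other free indices by one;
  \<open>lift p\<close> raises all free indices by one, which makes index 0 fresh.
\<close>

definition inst :: "trm \<Rightarrow> fm \<Rightarrow> fm" where
  "inst t = subst (case_nat t Var)"

definition lift :: "fm \<Rightarrow> fm" where
  "lift = subst (\<lambda>n. Var (Suc n))"

text \<open>
  Natural deduction. In \<open>ForallI\<close> and \<open>ExistsE\<close> the eigenvariable is index 0 and the usual
  freshness condition is expressed by lifting the side formulas.
\<close>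

inductive derives :: "fm set \<Rightarrow> fm \<Rightarrow> bool"  (infix "\<turnstile>" 40) where
  Assm: "p \<in> \<Gamma> \<Longrightarrow> \<Gamma> \<turnstile> p"
| Class: "insert (Neg p) \<Gamma> \<turnstile> Falsum \<Longrightarrow> \<Gamma> \<turnstile> p"
| ImpI: "insert p \<Gamma> \<turnstile> q \<Longrightarrow> \<Gamma> \<turnstile> p \<^bold>\<longrightarrow> q"
| ImpE: "\<Gamma> \<turnstile> p \<^bold>\<longrightarrow> q \<Longrightarrow> \<Gamma> \<turnstile> p \<Longrightarrow> \<Gamma> \<turnstile> q"
| ConI: "\<Gamma> \<turnstile> p \<Longrightarrow> \<Gamma> \<turnstile> q \<Longrightarrow> \<Gamma> \<turnstile> p \<^bold>\<and> q"
| ConE1: "\<Gamma> \<turnstile> p \<^bold>\<and> q \<Longrightarrow> \<Gamma> \<turnstile> p"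
| ConE2: "\<Gamma> \<turnstile> p \<^bold>\<and> q \<Longrightarrow> \<Gamma> \<turnstile> q"
| DisI1: "\<Gamma> \<turnstile> p \<Longrightarrow> \<Gamma> \<turnstile> p \<^bold>\<or> q"
| DisI2: "\<Gamma> \<turnstile> q \<Longrightarrow> \<Gamma> \<turnstile> p \<^bold>\<or> q"
| DisE: "\<Gamma> \<turnstile> p \<^bold>\<or> q \<Longrightarrow> insert p \<Gamma> \<turnstile> r \<Longrightarrow> insert q \<Gamma> \<turnstile> r \<Longrightarrow> \<Gamma> \<turnstile> r"
| ForallI: "lift ` \<Gamma> \<turnstile> p \<Longrightarrow> \<Gamma> \<turnstile> Forall p"
| ForallE: "\<Gamma> \<turnstile> Forall p \<Longrightarrow> \<Gamma> \<turnstile> inst t p"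
| ExistsI: "\<Gamma> \<turnstile> inst t p \<Longrightarrow> \<Gamma> \<turnstile> Exists p"
| ExistsE: "\<Gamma> \<turnstile> Exists p \<Longrightarrow> insert p (lift ` \<Gamma>) \<turnstile> lift q \<Longrightarrow> \<Gamma> \<turnstile> q"
| EqI: "\<Gamma> \<turnstile> t \<^bold>= t"
| EqE: "\<Gamma> \<turnstile> s \<^bold>= t \<Longrightarrow> \<Gamma> \<turnstile> inst s p \<Longrightarrow> \<Gamma> \<turnstile> inst t p"

text \<open>
  The axioms are the universal closures, with the quantifiers in the order given at
  the right of each axiom.
\<close>

definition F1 :: fm where  \<comment> \<open>\<open>x, y, z\<close>\<close>
  "F1 = Forall (Forall (Forall ((Var 2 \<^bold>\<uplus> Var 1) \<^bold>\<uplus> Var 0 \<^bold>= Var 2 \<^bold>\<uplus> (Var 1 \<^bold>\<uplus> Var 0))))"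

definition F2 :: fm where  \<comment> \<open>\<open>x, y\<close>\<close>
  "F2 = Forall (Forall (Var 1 \<^bold>\<uplus> Var 0 \<^bold>= Var 0 \<^bold>\<uplus> Var 1))"

definition F3 :: fm where  \<comment> \<open>\<open>x\<close>\<close>
  "F3 = Forall (Var 0 \<^bold>\<uplus> Emp \<^bold>= Var 0)"

definition F4 :: fm where  \<comment> \<open>\<open>x, y, z\<close>\<close>
  "F4 = Forall (Forall (Forall (Var 2 \<^bold>\<uplus> Var 0 \<^bold>= Var 1 \<^bold>\<uplus> Var 0 \<^bold>\<longrightarrow> Var 2 \<^bold>= Var 1)))"

definition F5 :: fm where  \<comment> \<open>\<open>x\<close>\<close>
  "F5 = Forall (Neg (Sing (Var 0) \<^bold>= Emp))"

definition F6 :: fm where  \<comment> \<open>\<open>x, y\<close>\<close>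
  "F6 = Forall (Forall (Var 1 \<^bold>\<uplus> Var 0 \<^bold>= Emp \<^bold>\<longrightarrow> Var 1 \<^bold>= Emp))"

definition F7 :: fm where  \<comment> \<open>\<open>x, y\<close>\<close>
  "F7 = Forall (Forall (Sing (Var 1) \<^bold>= Sing (Var 0) \<^bold>\<longrightarrow> Var 1 \<^bold>= Var 0))"

definition F8 :: fm where  \<comment> \<open>\<open>u, v, x, w\<close>; then \<open>w'\<close>\<close>
  "F8 = Forall (Forall (Forall (Forall
     (Var 3 \<^bold>\<uplus> Var 2 \<^bold>= Sing (Var 1) \<^bold>\<uplus> Var 0 \<^bold>\<longrightarrow>
      Exists (Var 4 \<^bold>= Sing (Var 2) \<^bold>\<uplus> Var 0 \<^bold>\<or> Var 3 \<^bold>= Sing (Var 2) \<^bold>\<uplus> Var 0)))))"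

definition F9 :: fm where  \<comment> \<open>\<open>x, t\<close>; then \<open>w, u\<close>\<close>
  "F9 = Forall (Forall
     (Var 1 \<^bold>\<sqsubseteq> Var 0 \<^bold>\<longleftrightarrow>
      (Var 1 \<^bold>= Var 0 \<^bold>\<or>
       Exists (Exists (Var 2 \<^bold>= Var 1 \<^bold>\<uplus> Sing (Var 0) \<^bold>\<and> Var 3 \<^bold>\<sqsubseteq> Var 0)))))"

definition Fminus :: "fm set" where
  "Fminus = {F1, F2, F3, F4, F5, F6, F7, F8, F9}"

definition pi_trm :: "trm \<Rightarrow> trm \<Rightarrow> trm" where
  "pi_trm x y = Sing x \<^bold>\<uplus> (Sing x \<^bold>\<uplus> Sing y)"

end

theory Submission
  imports Defs
begin

text \<open>
  Call \<open>a\<close> a member of \<open>s\<close> if \<open>s = \<langle>a\<rangle> \<uplus> w\<close> for some \<open>w\<close>. By \<open>F8\<close> a member of \<open>s \<uplus> t\<close> is a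
  member of \<open>s\<close> or of \<open>t\<close>, and cancellation shows that the only member of \<open>\<langle>a\<rangle>\<close> is \<open>a\<close>. Hence
  \<open>\<pi>(x,y) = \<pi>(u,v)\<close> gives \<open>x = u \<or> x = v\<close> and \<open>u = x \<or> u = y\<close>. If \<open>x = u\<close>, cancel \<open>\<langle>x\<rangle>\<close> twice;
  if \<open>x = v\<close> and \<open>u = y\<close>, cancel \<open>\<langle>x\<rangle> \<uplus> \<langle>y\<rangle>\<close> to get \<open>x = y\<close>.
\<close>

section \<open>Substitution and instantiation of nested quantifiers\<close>

abbreviation lift_trm :: "trm \<Rightarrow> trm" where
  "lift_trm \<equiv> subst_trm (\<lambda>n. Var (Suc n))"

lemma under_simps [simp]:
  "under \<sigma> 0 = Var 0"
  "under \<sigma> (Suc n) = lift_trm (\<sigma> n)"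
  by (simp_all add: under_def)

lemma subst_trm_subst_trm [simp]:
  "subst_trm \<sigma> (subst_trm \<tau> t) = subst_trm (\<lambda>n. subst_trm \<sigma> (\<tau> n)) t"
  by (induction t) simp_all

lemma subst_trm_Var [simp]: "subst_trm Var t = t"
  by (induction t) simp_all

lemma under_subst_trm:
  "(\<lambda>n. subst_trm (under \<sigma>) (under \<tau> n)) = under (\<lambda>n. subst_trm \<sigma> (\<tau> n))"
proof
  show "subst_trm (under \<sigma>) (under \<tau> n) = under (\<lambda>n. subst_trm \<sigma> (\<tau> n)) n" for n
    by (cases n) simp_all
qed

lemma subst_subst: "subst \<sigma> (subst \<tau> p) = subst (\<lambda>n. subst_trm \<sigma> (\<tau> n)) p"
  by (induction p arbitrary: \<sigma> \<tau>) (simp_all add: under_subst_trm)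

text \<open>Once the outer quantifiers are instantiated by \<sigma>, the next body carries
  \<open>under \<sigma>\<close>, and instantiating it only prepends t to \<sigma>. Iterated, this
  turns a block of universal eliminations into one simultaneous substitution.\<close>

lemma inst_subst_under: "inst t (subst (under \<sigma>) p) = subst (case_nat t \<sigma>) p"
proof -
  have "subst_trm (case_nat t Var) (under \<sigma> n) = case_nat t \<sigma> n" for n
    by (cases n) simp_all
  then show ?thesis
    by (simp add: inst_def subst_subst)
qed

lemma derives_Forall_subst: "\<Gamma> \<turnstile> Forall (subst (under \<sigma>) p) \<Longrightarrow> \<Gamma> \<turnstile> subst (case_nat t \<sigma>) p"
  by (metis ForallE inst_subst_under)

text \<open>Index 0 belongs to the innermost quantifier, so here and below the terms are listed from
  the inside outwards, in reverse of the order of quantification.\<close>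

lemma derives_Forall2:
  "\<Gamma> \<turnstile> Forall (Forall p) \<Longrightarrow> \<Gamma> \<turnstile> subst (case_nat t (case_nat s Var)) p"
  by (rule derives_Forall_subst) (auto dest: ForallE[where t = s] simp: inst_def)

lemma derives_Forall3:
  "\<Gamma> \<turnstile> Forall (Forall (Forall p)) \<Longrightarrow> \<Gamma> \<turnstile> subst (case_nat t (case_nat s (case_nat r Var))) p"
  by (rule derives_Forall_subst) (auto dest: derives_Forall2[where t = s and s = r])

lemma derives_Forall4:
  "\<Gamma> \<turnstile> Forall (Forall (Forall (Forall p))) \<Longrightarrow>
    \<Gamma> \<turnstile> subst (case_nat t (case_nat s (case_nat r (case_nat q Var)))) p"
  by (rule derives_Forall_subst) (auto dest: derives_Forall3[where t = s and s = r and r = q])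

lemma lift_simps:
  "lift (s \<^bold>= t) = (lift_trm s \<^bold>= lift_trm t)"
  "lift (p \<^bold>\<or> q) = (lift p \<^bold>\<or> lift q)"
  by (simp_all add: lift_def)

text \<open>The axioms are closed, so shifting free indices fixes them; the theory thus survives the
  lifting of contexts in the quantifier rules.\<close>

lemma lift_Fminus: "lift ` Fminus = Fminus"
  by (simp add: Fminus_def lift_def F1_def F2_def F3_def F4_def F5_def F6_def F7_def F8_def F9_def
      eval_nat_numeral)

section \<open>Derived rules for absurdity and equality\<close>

lemma derives_cut: "\<Gamma> \<turnstile> p \<Longrightarrow> insert p \<Gamma> \<turnstile> q \<Longrightarrow> \<Gamma> \<turnstile> q"
  using ImpE ImpI by blast

lemma derives_Falsum: "\<Gamma> \<turnstile> Falsum \<Longrightarrow> \<Gamma> \<turnstile> p"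
  \<comment> \<open>Cutting \<open>Falsum\<close> into the context keeps it available by
    \<open>Assm\<close> after \<open>Class\<close> adds \<open>Neg p\<close>.\<close>
  by (erule derives_cut) (simp add: Assm Class)

text \<open>Both instances are named by equations, so they can be matched by simplification. In each
  use p is a template: \<open>Var 0\<close> marks the place of replacement, and every other term is
  lifted past it.\<close>

lemma derives_eq_subst:
  assumes "\<Gamma> \<turnstile> s \<^bold>= t" and "\<Gamma> \<turnstile> p'" and "p' = inst s p" and "q' = inst t p"
  shows "\<Gamma> \<turnstile> q'"
  using EqE assms by blast

lemma derives_sym: "\<Gamma> \<turnstile> s \<^bold>= t \<Longrightarrow> \<Gamma> \<turnstile> t \<^bold>= s"
  by (erule derives_eq_subst[where p = "Var 0 \<^bold>= lift_trm s"], rule EqI[where t = s])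
    (simp_all add: inst_def)

lemma derives_trans [trans]: "\<Gamma> \<turnstile> r \<^bold>= s \<Longrightarrow> \<Gamma> \<turnstile> s \<^bold>= t \<Longrightarrow> \<Gamma> \<turnstile> r \<^bold>= t"
  by (erule derives_eq_subst[where p = "lift_trm r \<^bold>= Var 0", rotated])
    (simp_all add: inst_def)

lemma derives_Sing_cong: "\<Gamma> \<turnstile> s \<^bold>= t \<Longrightarrow> \<Gamma> \<turnstile> Sing s \<^bold>= Sing t"
  by (erule derives_eq_subst[where p = "lift_trm (Sing s) \<^bold>= Sing (Var 0)"],
      rule EqI[where t = "Sing s"]) (simp_all add: inst_def)

lemma derives_Uplus_cong:
  assumes "\<Gamma> \<turnstile> s \<^bold>= s'" and "\<Gamma> \<turnstile> t \<^bold>= t'"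
  shows "\<Gamma> \<turnstile> s \<^bold>\<uplus> t \<^bold>= s' \<^bold>\<uplus> t'"
proof -
  have "\<Gamma> \<turnstile> s \<^bold>\<uplus> t \<^bold>= s' \<^bold>\<uplus> t"
    by (rule derives_eq_subst[where p = "lift_trm (s \<^bold>\<uplus> t) \<^bold>= Var 0 \<^bold>\<uplus> lift_trm t"],
        rule assms(1), rule EqI[where t = "s \<^bold>\<uplus> t"]) (simp_all add: inst_def)
  also have "\<Gamma> \<turnstile> s' \<^bold>\<uplus> t \<^bold>= s' \<^bold>\<uplus> t'"
    by (rule derives_eq_subst[where p = "lift_trm (s' \<^bold>\<uplus> t) \<^bold>= lift_trm s' \<^bold>\<uplus> Var 0"],
        rule assms(2), rule EqI[where t = "s' \<^bold>\<uplus> t"]) (simp_all add: inst_def)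
  finally show ?thesis .
qed

definition mem :: "trm \<Rightarrow> trm \<Rightarrow> fm" where
  "mem a s = Exists (lift_trm s \<^bold>= Sing (lift_trm a) \<^bold>\<uplus> Var 0)"

lemma lift_mem: "lift (mem a s) = mem (lift_trm a) (lift_trm s)"
  by (simp add: lift_def mem_def)

lemma derives_memI: "\<Gamma> \<turnstile> s \<^bold>= Sing a \<^bold>\<uplus> w \<Longrightarrow> \<Gamma> \<turnstile> mem a s"
  unfolding mem_def by (rule ExistsI[where t = w]) (simp add: inst_def)

section \<open>Consequences of the axioms\<close>

context
  fixes \<Gamma> :: "fm set"
  assumes Fminus: "Fminus \<subseteq> \<Gamma>"
begin

lemma derives_assoc: "\<Gamma> \<turnstile> (r \<^bold>\<uplus> s) \<^bold>\<uplus> t \<^bold>= r \<^bold>\<uplus> (s \<^bold>\<uplus> t)"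
proof -
  have "\<Gamma> \<turnstile> F1" using Fminus by (auto simp: Fminus_def intro: Assm)
  from derives_Forall3[OF this[unfolded F1_def], of t s r] show ?thesis
    by (simp add: eval_nat_numeral)
qed

lemma derives_comm: "\<Gamma> \<turnstile> s \<^bold>\<uplus> t \<^bold>= t \<^bold>\<uplus> s"
proof -
  have "\<Gamma> \<turnstile> F2" using Fminus by (auto simp: Fminus_def intro: Assm)
  from derives_Forall2[OF this[unfolded F2_def], of t s] show ?thesis
    by simp
qed

lemma derives_Emp_right: "\<Gamma> \<turnstile> s \<^bold>\<uplus> Emp \<^bold>= s"
proof -
  have "\<Gamma> \<turnstile> F3" using Fminus by (auto simp: Fminus_def intro: Assm)
  from ForallE[OF this[unfolded F3_def], of s] show ?thesis
    by (simp add: inst_def)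
qed

lemma derives_cancel_right:
  assumes "\<Gamma> \<turnstile> r \<^bold>\<uplus> t \<^bold>= s \<^bold>\<uplus> t"
  shows "\<Gamma> \<turnstile> r \<^bold>= s"
proof -
  have "\<Gamma> \<turnstile> F4" using Fminus by (auto simp: Fminus_def intro: Assm)
  from derives_Forall3[OF this[unfolded F4_def], of t s r]
  have "\<Gamma> \<turnstile> r \<^bold>\<uplus> t \<^bold>= s \<^bold>\<uplus> t \<^bold>\<longrightarrow> r \<^bold>= s"
    by (simp add: eval_nat_numeral)
  then show ?thesis using assms by (rule ImpE)
qed

lemma derives_Sing_neq_Emp:
  assumes "\<Gamma> \<turnstile> Sing s \<^bold>= Emp"
  shows "\<Gamma> \<turnstile> p"
proof -
  have "\<Gamma> \<turnstile> F5" using Fminus by (auto simp: Fminus_def intro: Assm)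
  from ForallE[OF this[unfolded F5_def], of s] have "\<Gamma> \<turnstile> Neg (Sing s \<^bold>= Emp)"
    by (simp add: inst_def)
  from ImpE[OF this assms] show ?thesis by (rule derives_Falsum)
qed

lemma derives_Uplus_eq_Emp:
  assumes "\<Gamma> \<turnstile> s \<^bold>\<uplus> t \<^bold>= Emp"
  shows "\<Gamma> \<turnstile> s \<^bold>= Emp"
proof -
  have "\<Gamma> \<turnstile> F6" using Fminus by (auto simp: Fminus_def intro: Assm)
  from derives_Forall2[OF this[unfolded F6_def], of t s]
  have "\<Gamma> \<turnstile> s \<^bold>\<uplus> t \<^bold>= Emp \<^bold>\<longrightarrow> s \<^bold>= Emp"
    by simp
  then show ?thesis using assms by (rule ImpE)
qed

lemma derives_Sing_inj:
  assumes "\<Gamma> \<turnstile> Sing s \<^bold>= Sing t"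
  shows "\<Gamma> \<turnstile> s \<^bold>= t"
proof -
  have "\<Gamma> \<turnstile> F7" using Fminus by (auto simp: Fminus_def intro: Assm)
  from derives_Forall2[OF this[unfolded F7_def], of t s]
  have "\<Gamma> \<turnstile> Sing s \<^bold>= Sing t \<^bold>\<longrightarrow> s \<^bold>= t"
    by simp
  then show ?thesis using assms by (rule ImpE)
qed

lemma derives_F8:
  assumes "\<Gamma> \<turnstile> s \<^bold>\<uplus> t \<^bold>= Sing a \<^bold>\<uplus> w"
  shows "\<Gamma> \<turnstile> Exists (lift_trm s \<^bold>= Sing (lift_trm a) \<^bold>\<uplus> Var 0 \<^bold>\<or>
                  lift_trm t \<^bold>= Sing (lift_trm a) \<^bold>\<uplus> Var 0)"
proof -
  have "\<Gamma> \<turnstile> F8" using Fminus by (auto simp: Fminus_def intro: Assm)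
  from derives_Forall4[OF this[unfolded F8_def], of w a t s]
  have "\<Gamma> \<turnstile> s \<^bold>\<uplus> t \<^bold>= Sing a \<^bold>\<uplus> w \<^bold>\<longrightarrow>
      Exists (lift_trm s \<^bold>= Sing (lift_trm a) \<^bold>\<uplus> Var 0 \<^bold>\<or>
              lift_trm t \<^bold>= Sing (lift_trm a) \<^bold>\<uplus> Var 0)"
    by (simp add: eval_nat_numeral)
  then show ?thesis using assms by (rule ImpE)
qed

lemma derives_cancel_left:
  assumes "\<Gamma> \<turnstile> t \<^bold>\<uplus> r \<^bold>= t \<^bold>\<uplus> s"
  shows "\<Gamma> \<turnstile> r \<^bold>= s"
  by (rule derives_cancel_right) (rule derives_trans[OF derives_trans[OF derives_comm assms] derives_comm])

lemma derives_absorb: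
  assumes "\<Gamma> \<turnstile> t \<^bold>= t \<^bold>\<uplus> s"
  shows "\<Gamma> \<turnstile> s \<^bold>= Emp"
proof (rule derives_cancel_left)
  show "\<Gamma> \<turnstile> t \<^bold>\<uplus> s \<^bold>= t \<^bold>\<uplus> Emp"
    using derives_sym[OF assms] derives_sym[OF derives_Emp_right] by (rule derives_trans)
qed

text \<open>In \<open>F8\<close> one existential governs the whole disjunction; distributing it
  gives a case split on membership.\<close>

lemma derives_Uplus_memE:
  assumes "\<Gamma> \<turnstile> s \<^bold>\<uplus> t \<^bold>= Sing a \<^bold>\<uplus> w"
    and "insert (mem a s) \<Gamma> \<turnstile> q" and "insert (mem a t) \<Gamma> \<turnstile> q"
  shows "\<Gamma> \<turnstile> q"
proof -
  have "\<Gamma> \<turnstile> mem a s \<^bold>\<or> mem a t"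
  \<comment> \<open>Each branch uses only its own disjunct, with \<open>Var 0\<close> as the
    witness, so the remaining context \<Delta> is arbitrary.\<close>
  proof (rule ExistsE[OF derives_F8[OF assms(1)]], rule DisE, rule Assm, rule insertI1)
    show "insert (lift_trm s \<^bold>= Sing (lift_trm a) \<^bold>\<uplus> Var 0) \<Delta> \<turnstile> lift (mem a s \<^bold>\<or> mem a t)" for \<Delta>
      unfolding lift_simps lift_mem by (rule DisI1, rule derives_memI, rule Assm, rule insertI1)
    show "insert (lift_trm t \<^bold>= Sing (lift_trm a) \<^bold>\<uplus> Var 0) \<Delta> \<turnstile> lift (mem a s \<^bold>\<or> mem a t)" for \<Delta>
      unfolding lift_simps lift_mem by (rule DisI2, rule derives_memI, rule Assm, rule insertI1)
  qed
  then show ?thesis using assms(2,3) by (rule DisE)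
qed

text \<open>Substituting one equation into the other gives \<langle>a\<rangle> = \<langle>a\<rangle>
  \<uplus> (w' \<uplus> w). Cancellation and \<open>F6\<close> make w' empty, so \<langle>x\<rangle>
  = \<langle>a\<rangle>.\<close>

lemma derives_mutual_Sing:
  assumes ax: "\<Gamma> \<turnstile> Sing a \<^bold>= Sing x \<^bold>\<uplus> w" and xa: "\<Gamma> \<turnstile> Sing x \<^bold>= Sing a \<^bold>\<uplus> w'"
  shows "\<Gamma> \<turnstile> x \<^bold>= a"
proof -
  have "\<Gamma> \<turnstile> Sing a \<^bold>= (Sing a \<^bold>\<uplus> w') \<^bold>\<uplus> w"
    using ax derives_Uplus_cong[OF xa EqI] by (rule derives_trans)
  also note derives_assoc
  finally have "\<Gamma> \<turnstile> w' \<^bold>\<uplus> w \<^bold>= Emp" by (rule derives_absorb)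
  then have "\<Gamma> \<turnstile> w' \<^bold>= Emp" by (rule derives_Uplus_eq_Emp)
  note xa
  also note derives_Uplus_cong[OF EqI \<open>\<Gamma> \<turnstile> w' \<^bold>= Emp\<close>]
  also note derives_Emp_right
  finally show ?thesis by (rule derives_Sing_inj)
qed

text \<open>The hypotheses are contradictory: \<langle>a\<rangle> = \<langle>a\<rangle> \<uplus> (w'
  \<uplus> \<langle>x\<rangle>) would make \<langle>x\<rangle> empty, against
  \<open>F5\<close>.\<close>

lemma derives_circular_Sing:
  assumes ax: "\<Gamma> \<turnstile> Sing a \<^bold>= Sing x \<^bold>\<uplus> w" and w: "\<Gamma> \<turnstile> w \<^bold>= Sing a \<^bold>\<uplus> w'"
  shows "\<Gamma> \<turnstile> p"
proof -
  note ax
  also note derives_Uplus_cong[OF EqI w]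
  also note derives_comm
  also note derives_assoc
  finally have "\<Gamma> \<turnstile> w' \<^bold>\<uplus> Sing x \<^bold>= Emp" by (rule derives_absorb)
  from derives_trans[OF derives_comm this] have "\<Gamma> \<turnstile> Sing x \<^bold>= Emp"
    by (rule derives_Uplus_eq_Emp)
  then show ?thesis by (rule derives_Sing_neq_Emp)
qed

end

lemma Fminus_lift: "Fminus \<subseteq> \<Gamma> \<Longrightarrow> Fminus \<subseteq> insert p (lift ` \<Gamma>)"
  using lift_Fminus by blast

lemma derives_memE:
  assumes "\<Gamma> \<turnstile> mem a s"
    and "insert (lift_trm s \<^bold>= Sing (lift_trm a) \<^bold>\<uplus> Var 0) (lift ` \<Gamma>) \<turnstile> lift q"
  shows "\<Gamma> \<turnstile> q"
  using ExistsE assms unfolding mem_def by blast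

text \<open>Apply \<open>F8\<close> with the roles of a and x exchanged: a is a member of
  \<langle>x\<rangle>, the mutual case, or of w, the circular case.\<close>

lemma derives_Sing_eq_Uplus:
  assumes \<Gamma>: "Fminus \<subseteq> \<Gamma>" and ax: "(Sing a \<^bold>= Sing x \<^bold>\<uplus> w) \<in> \<Gamma>"
  shows "\<Gamma> \<turnstile> x \<^bold>= a"
proof (rule derives_Uplus_memE[OF \<Gamma>])
  \<comment> \<open>Padding with \<open>Emp\<close> gives \<langle>a\<rangle> the form required on
    the right of \<open>F8\<close>.\<close>
  show "\<Gamma> \<turnstile> Sing x \<^bold>\<uplus> w \<^bold>= Sing a \<^bold>\<uplus> Emp"
    using derives_sym[OF Assm[OF ax]] derives_sym[OF derives_Emp_right[OF \<Gamma>]] by (rule derives_trans)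
  \<comment> \<open>As an element of \<Gamma>, the equation \<open>ax\<close> passes directly into
    the lifted context.\<close>
  have lift_ax: "insert p (lift ` insert q \<Gamma>) \<turnstile> Sing (lift_trm a) \<^bold>= Sing (lift_trm x) \<^bold>\<uplus> lift_trm w"
    for p q
    using ax by (intro Assm) (force simp: lift_def image_iff)
  have Fminus': "Fminus \<subseteq> insert p (lift ` insert q \<Gamma>)" for p q
    using Fminus_lift[of "insert q \<Gamma>"] \<Gamma> by blast
  show "insert (mem a (Sing x)) \<Gamma> \<turnstile> x \<^bold>= a"
    by (rule derives_memE[OF Assm[OF insertI1]], unfold lift_simps subst_trm.simps,
        rule derives_mutual_Sing[OF Fminus' lift_ax], rule Assm, rule insertI1)
  show "insert (mem a w) \<Gamma> \<turnstile> x \<^bold>= a"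
    by (rule derives_memE[OF Assm[OF insertI1]],
        rule derives_circular_Sing[OF Fminus' lift_ax], rule Assm, rule insertI1)
qed

lemma derives_mem_Sing:
  assumes "Fminus \<subseteq> \<Gamma>" and "mem x (Sing a) \<in> \<Gamma>"
  shows "\<Gamma> \<turnstile> x \<^bold>= a"
proof (rule derives_memE[OF Assm[OF assms(2)]])
  show "insert (lift_trm (Sing a) \<^bold>= Sing (lift_trm x) \<^bold>\<uplus> Var 0) (lift ` \<Gamma>) \<turnstile> lift (x \<^bold>= a)"
    unfolding lift_simps subst_trm.simps
    by (rule derives_Sing_eq_Uplus[OF Fminus_lift[OF assms(1)] insertI1])
qed

lemma derives_mem_Uplus:
  assumes \<Gamma>: "Fminus \<subseteq> \<Gamma>" and "mem a (s \<^bold>\<uplus> t) \<in> \<Gamma>"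
  shows "\<Gamma> \<turnstile> mem a s \<^bold>\<or> mem a t"
proof (rule derives_memE[OF Assm[OF assms(2)]])
  let ?\<Delta> = "insert (lift_trm (s \<^bold>\<uplus> t) \<^bold>= Sing (lift_trm a) \<^bold>\<uplus> Var 0) (lift ` \<Gamma>)"
  have "?\<Delta> \<turnstile> mem (lift_trm a) (lift_trm s) \<^bold>\<or> mem (lift_trm a) (lift_trm t)"
    by (rule derives_Uplus_memE[OF Fminus_lift[OF \<Gamma>]])
      (auto intro: Assm DisI1[OF Assm] DisI2[OF Assm])
  then show "?\<Delta> \<turnstile> lift (mem a s \<^bold>\<or> mem a t)"
    by (simp add: lift_simps lift_mem)
qed

section \<open>Comparing the components of two pairs\<close>

lemma derives_pi_first:
  assumes \<Gamma>: "Fminus \<subseteq> \<Gamma>" and eq: "\<Gamma> \<turnstile> pi_trm u v \<^bold>= pi_trm x y"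
  shows "\<Gamma> \<turnstile> x \<^bold>= u \<^bold>\<or> x \<^bold>= v"
\<comment> \<open>Unfolded, the right side already has the form \<langle>x\<rangle> \<uplus> w, so x
  is a member of the left pair.\<close>
proof (rule derives_Uplus_memE[OF \<Gamma> eq[unfolded pi_trm_def]])
  have u: "Fminus \<subseteq> \<Delta> \<Longrightarrow> insert (mem x (Sing u)) \<Delta> \<turnstile> x \<^bold>= u \<^bold>\<or> x \<^bold>= v" for \<Delta>
    by (intro DisI1 derives_mem_Sing) auto
  have v: "Fminus \<subseteq> \<Delta> \<Longrightarrow> insert (mem x (Sing v)) \<Delta> \<turnstile> x \<^bold>= u \<^bold>\<or> x \<^bold>= v" for \<Delta>
    by (intro DisI2 derives_mem_Sing) auto
  show "insert (mem x (Sing u)) \<Gamma> \<turnstile> x \<^bold>= u \<^bold>\<or> x \<^bold>= v"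
    using \<Gamma> by (rule u)
  show "insert (mem x (Sing u \<^bold>\<uplus> Sing v)) \<Gamma> \<turnstile> x \<^bold>= u \<^bold>\<or> x \<^bold>= v"
    using \<Gamma> by (intro DisE[OF derives_mem_Uplus[OF _ insertI1]] u v) auto
qed

lemma derives_pi_second:
  assumes \<Gamma>: "Fminus \<subseteq> \<Gamma>"
    and eq: "\<Gamma> \<turnstile> pi_trm x y \<^bold>= pi_trm u v" and xu: "\<Gamma> \<turnstile> x \<^bold>= u"
  shows "\<Gamma> \<turnstile> y \<^bold>= v"
proof -
  note ux = derives_Sing_cong[OF derives_sym[OF xu]]
  note eq[unfolded pi_trm_def]
  also note derives_Uplus_cong[OF ux derives_Uplus_cong[OF ux EqI]]
  finally show ?thesis
    by (rule derives_Sing_inj[OF \<Gamma> derives_cancel_left[OF \<Gamma> derives_cancel_left[OF \<Gamma>]]])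
qed

lemma derives_pi_crossed:
  assumes \<Gamma>: "Fminus \<subseteq> \<Gamma>" and eq: "\<Gamma> \<turnstile> pi_trm x y \<^bold>= pi_trm u v"
    and xv: "\<Gamma> \<turnstile> x \<^bold>= v" and uy: "\<Gamma> \<turnstile> u \<^bold>= y"
  shows "\<Gamma> \<turnstile> x \<^bold>= u"
proof -
  note uy' = derives_Sing_cong[OF uy] and vx' = derives_Sing_cong[OF derives_sym[OF xv]]
  note eq[unfolded pi_trm_def]
  also note derives_Uplus_cong[OF uy' derives_Uplus_cong[OF uy' vx']]
  \<comment> \<open>The right side is now \<langle>y\<rangle> \<uplus> (\<langle>y\<rangle> \<uplus>
    \<langle>x\<rangle>); commuting the inner sum exposes the block \<langle>x\<rangle> \<uplus>
    \<langle>y\<rangle> shared with the left side.\<close>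
  also note derives_Uplus_cong[OF EqI derives_comm[OF \<Gamma>]]
  finally have "\<Gamma> \<turnstile> x \<^bold>= y"
    by (rule derives_Sing_inj[OF \<Gamma> derives_cancel_right[OF \<Gamma>]])
  then show ?thesis using derives_sym[OF uy] by (rule derives_trans)
qed

lemma derives_pi_inj:
  assumes \<Gamma>: "Fminus \<subseteq> \<Gamma>" and eq: "(pi_trm x y \<^bold>= pi_trm u v) \<in> \<Gamma>"
  shows "\<Gamma> \<turnstile> x \<^bold>= u \<^bold>\<and> y \<^bold>= v"
proof -
  have "\<Gamma> \<turnstile> x \<^bold>= u"
  proof (rule DisE[OF derives_pi_first[OF \<Gamma> derives_sym[OF Assm[OF eq]]]])
    let ?\<Delta> = "insert (x \<^bold>= v) \<Gamma>"
    show "insert (x \<^bold>= u) \<Gamma> \<turnstile> x \<^bold>= u"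
      by (simp add: Assm)
    have \<Delta>: "Fminus \<subseteq> ?\<Delta>" and eq': "?\<Delta> \<turnstile> pi_trm x y \<^bold>= pi_trm u v"
      using \<Gamma> eq by (auto intro: Assm)
    show "?\<Delta> \<turnstile> x \<^bold>= u"
    \<comment> \<open>With the pairs in the opposite roles, u is compared with x and y.\<close>
    proof (rule DisE[OF derives_pi_first[OF \<Delta> eq']])
      show "insert (u \<^bold>= x) ?\<Delta> \<turnstile> x \<^bold>= u"
        by (simp add: Assm derives_sym)
      show "insert (u \<^bold>= y) ?\<Delta> \<turnstile> x \<^bold>= u"
        by (rule derives_pi_crossed[where y = y and v = v]) (use \<Gamma> eq in \<open>auto intro: Assm\<close>)
    qed
  qed
  then show ?thesis
    using derives_pi_second[OF \<Gamma> Assm[OF eq]] by (simp add: ConI)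
qed

theorem lemma4p2:
  "Fminus \<turnstile>
     Forall (Forall (Forall (Forall
       (pi_trm (Var 3) (Var 2) \<^bold>= pi_trm (Var 1) (Var 0) \<^bold>\<longrightarrow>
        (Var 3 \<^bold>= Var 1 \<^bold>\<and> Var 2 \<^bold>= Var 0)))))"
  \<comment> \<open>The four uses of \<open>ForallI\<close> lift the theory four times, leaving it
    unchanged.\<close>
  by (intro ForallI ImpI derives_pi_inj) (auto simp: lift_Fminus)

end
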